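(* Let $a\in\mathbb{R}$, $\alpha \in (0,1]$, $c,d \in \mathbb{R}$, and let $J \subset [a,\infty)$ be a (finite or infinite) interval. Let $f,g\colon[a,\infty)\to\mathbb{R}$ satisfy $f,g \in C^{\alpha}_a (J, \mathbb{R})$, i.e. $f$ and $g$ are $\alpha$-differentiable at every point of $J$. Then for every $t \in J$ the following hold (the conformable derivatives on the left-hand sides existing): (i) $T^{\alpha}_a (cf+dg)(t) = c\,T^{\alpha}_a f(t) + d\,T^{\alpha}_a g(t)$; (ii) $T^{\alpha}_a (fg)(t) = g(t)\,T^{\alpha}_a f(t) + f(t)\,T^{\alpha}_a g(t)$; (iii) $T^{\alpha}_a (f g^{-1})(t) = \dfrac{g(t)\,T^{\alpha}_a f(t) - f(t)\,T^{\alpha}_a g(t)}{g(t)^{2}}$, provided $g(t)\neq 0$, where $g^{-1}=1/g$; (iv) $T^{\alpha}_a (1)(t) = 0$, where $1$ denotes the constant function; (v) $T^{\alpha}_a f(t) = (t - a)^{1-\alpha}f'(t)$, excluding the case $t=a$, $\alpha=1$ (here $f'(t)$ is the first derivative of $f$ at $t$, meaning the right derivative if $t=a$).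
   Context: Let $a\in\mathbb{R}$ (the lower terminal) and $f\colon[a,\infty)\to\mathbb{R}$. The conformable derivative $T_a^\alpha f$ of order $\alpha\in(0,1]$ is defined as follows. (1) For $t\in(a,\infty)$: $T^{\alpha}_a f(t) = \lim_{\theta \to 0}\frac{f(t+\theta(t-a)^{1-\alpha}) - f(t)}{\theta}$, if the (finite) limit exists. (2) At $t=a$: $T_a^\alpha f(a)$ exists if and only if the right first derivative $f'(a)$ of $f$ at $a$ exists, and then $T_a^1 f(a)=f'(a)$, while $T_a^\alpha f(a)=0$ for $\alpha\in(0,1)$. $f$ is called $\alpha$-differentiable at a point if $T_a^\alpha f$ exists at that point. For an interval $J\subset[a,\infty)$, $f\in C_a^\alpha(J,\mathbb{R})$ means that $f$ is $\alpha$-differentiable at every point of $J$. The conformable derivative at $t$ depends only on the values of the function near $t$ in $[a,\infty)$, so it is also meaningful for functions (such as a quotient) defined only in a neighbourhood of $t$ in $[a,\infty)$. *)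

theory Defs
  imports "HOL-Analysis.Analysis"
begin

text \<open>
  A function on the half-line from the lower terminal \<open>a\<close> is represented by a total function on
  the reals; all notions below depend on its values on \<open>{a..}\<close> only. In particular nothing is
  conformably differentiable at a point \<open>t < a\<close>.  The order \<open>\<alpha>\<close> is meant to lie in \<open>{0<..1}\<close>.
\<close>

definition has_conformable_derivative ::
    "real \<Rightarrow> real \<Rightarrow> (real \<Rightarrow> real) \<Rightarrow> real \<Rightarrow> real \<Rightarrow> bool" where
  "has_conformable_derivative a \<alpha> f D t \<longleftrightarrow>
     (t > a \<and> ((\<lambda>\<theta>. (f (t + \<theta> * (t - a) powr (1 - \<alpha>)) - f t) / \<theta>) \<longlongrightarrow> D) (at 0)) \<or>
     (t = a \<and> (\<exists>D'. (f has_real_derivative D') (at_right a) \<and> D = (if \<alpha> = 1 then D' else 0)))"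

definition conformable_differentiable ::
    "real \<Rightarrow> real \<Rightarrow> (real \<Rightarrow> real) \<Rightarrow> real \<Rightarrow> bool" where
  "conformable_differentiable a \<alpha> f t \<longleftrightarrow> (\<exists>D. has_conformable_derivative a \<alpha> f D t)"

definition conformable_deriv :: "real \<Rightarrow> real \<Rightarrow> (real \<Rightarrow> real) \<Rightarrow> real \<Rightarrow> real" where
  "conformable_deriv a \<alpha> f t = (THE D. has_conformable_derivative a \<alpha> f D t)"

definition conformable_differentiable_on ::
    "real \<Rightarrow> real \<Rightarrow> (real \<Rightarrow> real) \<Rightarrow> real set \<Rightarrow> bool" where
  "conformable_differentiable_on a \<alpha> f J \<longleftrightarrow> (\<forall>t\<in>J. conformable_differentiable a \<alpha> f t)"

lemma has_conformable_derivative_unique: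
  assumes "has_conformable_derivative a \<alpha> f D t" "has_conformable_derivative a \<alpha> f E t"
  shows "D = E"
proof (cases "t = a")
  case True
  then obtain D' E' where
    D: "(f has_real_derivative D') (at_right a)" "D = (if \<alpha> = 1 then D' else 0)" and
    E: "(f has_real_derivative E') (at_right a)" "E = (if \<alpha> = 1 then E' else 0)"
    using assms unfolding has_conformable_derivative_def by auto
  have "D' = E'"
    using D(1) E(1) unfolding has_field_derivative_iff
    by (rule tendsto_unique[OF trivial_limit_at_right_real])
  then show ?thesis using D(2) E(2) by simp
next
  case False
  then show ?thesis
    using assms tendsto_unique[OF at_neq_bot] unfolding has_conformable_derivative_def by blast
qed

lemma conformable_deriv_eqI:
  "has_conformable_derivative a \<alpha> f D t \<Longrightarrow> conformable_deriv a \<alpha> f t = D"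
  unfolding conformable_deriv_def by (blast intro: has_conformable_derivative_unique)

end

theory Submission
  imports Defs
begin

text \<open>
  Substituting \<open>h = \<theta> (t - a) powr (1 - \<alpha>)\<close> shows that \<open>f\<close> is conformably differentiable at \<open>t\<close>
  exactly if it is differentiable there, one-sidedly at \<open>t = a\<close>, and that the conformable derivative
  is the ordinary one times a factor that does not depend on \<open>f\<close>. All rules follow from the
  classical ones.
\<close>

text \<open>
  The factor is \<open>(t - a) powr (1 - \<alpha>)\<close>, except that \<open>0 powr 0 = 0\<close> gives the wrong value at \<open>t = a\<close>,
  \<open>\<alpha> = 1\<close>.
\<close>

definition conformable_factor :: "real \<Rightarrow> real \<Rightarrow> real \<Rightarrow> real" where
  "conformable_factor a \<alpha> t = (if t = a \<and> \<alpha> = 1 then 1 else (t - a) powr (1 - \<alpha>))"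

lemma filterlim_times_at_0:
  fixes k :: "'a::real_normed_field"
  assumes "k \<noteq> 0"
  shows "filterlim (\<lambda>x. x * k) (at 0) (at 0)"
  unfolding filterlim_at using assms
  by (auto intro!: tendsto_eq_intros simp: eventually_at_filter)

text \<open>As \<open>k\<close> is nonzero, multiplication by \<open>k\<close> and by
  \<open>inverse k\<close> both map \<open>at 0\<close> to \<open>at 0\<close>, so composition turns
  either limit into the other.\<close>

lemma scaled_difference_quotient_tendsto_iff:
  fixes f :: "'a::real_normed_field \<Rightarrow> 'a"
  assumes k: "k \<noteq> 0"
  shows "((\<lambda>\<theta>. (f (t + \<theta> * k) - f t) / \<theta>) \<longlongrightarrow> k * f') (at 0) \<longleftrightarrow>
    (f has_field_derivative f') (at t)"
proof
  assume "((\<lambda>\<theta>. (f (t + \<theta> * k) - f t) / \<theta>) \<longlongrightarrow> k * f') (at 0)"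
  moreover have "filterlim (\<lambda>h. h * inverse k) (at 0) (at 0)"
    using k by (intro filterlim_times_at_0) simp
  ultimately have "((\<lambda>h. (f (t + h * inverse k * k) - f t) / (h * inverse k)) \<longlongrightarrow> k * f') (at 0)"
    by (rule filterlim_compose)
  \<comment> \<open>Dividing by \<open>h * inverse k\<close> leaves an extra factor \<open>k\<close>
    on the quotient by \<open>h\<close>; it is removed here from the quotient and from the
    limit.\<close>
  then have "((\<lambda>h. inverse k * ((f (t + h * inverse k * k) - f t) / (h * inverse k)))
      \<longlongrightarrow> inverse k * (k * f')) (at 0)"
    by (rule tendsto_mult_left)
  then show "(f has_field_derivative f') (at t)"
    unfolding DERIV_def using k
    by (simp add: mult.assoc divide_inverse mult.left_commute[of "inverse k"]
        flip: mult.assoc[of k "inverse k" f'])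
next
  assume "(f has_field_derivative f') (at t)"
  then have "((\<lambda>h. (f (t + h) - f t) / h) \<longlongrightarrow> f') (at 0)"
    unfolding DERIV_def .
  then have "((\<lambda>\<theta>. (f (t + \<theta> * k) - f t) / (\<theta> * k)) \<longlongrightarrow> f') (at 0)"
    using filterlim_times_at_0[OF k] by (rule filterlim_compose)
  then have "((\<lambda>\<theta>. k * ((f (t + \<theta> * k) - f t) / (\<theta> * k))) \<longlongrightarrow> k * f') (at 0)"
    by (rule tendsto_mult_left)
  then show "((\<lambda>\<theta>. (f (t + \<theta> * k) - f t) / \<theta>) \<longlongrightarrow> k * f') (at 0)"
    using k by simp
qed

text \<open>The filter \<open>at t within {a..}\<close> is \<open>at_right a\<close> at the terminal
  and \<open>at t\<close> beyond it, so one formula covers both clauses of the definition and the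
  later rules need no case split.\<close>

lemma has_conformable_derivative_iff:
  "has_conformable_derivative a \<alpha> f D t \<longleftrightarrow>
    t \<ge> a \<and> (\<exists>f'. (f has_real_derivative f') (at t within {a..}) \<and>
      D = conformable_factor a \<alpha> t * f')"
proof (cases t a rule: linorder_cases)
  case less
  then show ?thesis by (simp add: has_conformable_derivative_def)
next
  case equal
  \<comment> \<open>Since \<open>0 powr x = 0\<close> for every \<open>x\<close>, the factor at
    \<open>a\<close> is 1 for \<alpha> = 1 and 0 otherwise.\<close>
  then show ?thesis
    by (auto simp: has_conformable_derivative_def conformable_factor_def at_within_Ici_at_right)
next
  case greater
  define k where "k = (t - a) powr (1 - \<alpha>)"
  have k: "k \<noteq> 0" "conformable_factor a \<alpha> t = k"
    using greater by (simp_all add: k_def conformable_factor_def)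
  have "at t within {a..} = at t"
    using greater by (intro at_within_interior) simp
  \<comment> \<open>The choice \<open>D / k\<close> for the ordinary derivative makes the limit
    \<open>k * (D / k) = D\<close>.\<close>
  moreover have "has_conformable_derivative a \<alpha> f D t \<longleftrightarrow>
      (f has_real_derivative D / k) (at t)"
    using greater k scaled_difference_quotient_tendsto_iff[of k f t "D / k"]
    by (simp add: has_conformable_derivative_def k_def)
  moreover have "D = k * f' \<longleftrightarrow> f' = D / k" for f'
    using k by (auto simp: field_simps)
  ultimately show ?thesis
    using greater k by auto
qed

text \<open>The value \<open>D\<close> is tied to the factor by an equation only, so it may be any
  expression in other conformable derivatives.\<close>

lemma has_conformable_derivativeI:
  assumes "(f has_real_derivative f') (at t within {a..})" "t \<ge> a"
    "D = conformable_factor a \<alpha> t * f'"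
  shows "conformable_differentiable a \<alpha> f t \<and> conformable_deriv a \<alpha> f t = D"
  using assms conformable_deriv_eqI[of a \<alpha> f D t]
  unfolding conformable_differentiable_def has_conformable_derivative_iff by blast

text \<open>The factor vanishes at \<open>t = a\<close> for \<alpha> < 1, so \<open>f'\<close>
  cannot be recovered from the value of the conformable derivative; it comes from differentiability
  itself.\<close>

lemma conformable_differentiableE:
  assumes "conformable_differentiable a \<alpha> f t"
  obtains f' where "(f has_real_derivative f') (at t within {a..})" "t \<ge> a"
    "conformable_deriv a \<alpha> f t = conformable_factor a \<alpha> t * f'"
  using assms conformable_deriv_eqI[of a \<alpha> f _ t]
  unfolding conformable_differentiable_def has_conformable_derivative_iff by blast

theorem theorem5p2:
  fixes a \<alpha> c d t :: real and J :: "real set" and f g :: "real \<Rightarrow> real"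
  assumes "0 < \<alpha>" and "\<alpha> \<le> 1"
    and "is_interval J" and "J \<subseteq> {a..}"
    and "conformable_differentiable_on a \<alpha> f J"
    and "conformable_differentiable_on a \<alpha> g J"
    and "t \<in> J"
  shows
    "(conformable_differentiable a \<alpha> (\<lambda>s. c * f s + d * g s) t \<and>
      conformable_deriv a \<alpha> (\<lambda>s. c * f s + d * g s) t =
        c * conformable_deriv a \<alpha> f t + d * conformable_deriv a \<alpha> g t) \<and>
     (conformable_differentiable a \<alpha> (\<lambda>s. f s * g s) t \<and>
      conformable_deriv a \<alpha> (\<lambda>s. f s * g s) t =
        g t * conformable_deriv a \<alpha> f t + f t * conformable_deriv a \<alpha> g t) \<and>
     (g t \<noteq> 0 \<longrightarrow>
      (\<forall>\<^sub>F s in at t within {a..}. g s \<noteq> 0) \<and>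
      conformable_differentiable a \<alpha> (\<lambda>s. f s * (1 / g s)) t \<and>
      conformable_deriv a \<alpha> (\<lambda>s. f s * (1 / g s)) t =
        (g t * conformable_deriv a \<alpha> f t - f t * conformable_deriv a \<alpha> g t) / (g t)\<^sup>2) \<and>
     (conformable_differentiable a \<alpha> (\<lambda>s. 1) t \<and>
      conformable_deriv a \<alpha> (\<lambda>s. 1) t = 0) \<and>
     (\<not> (t = a \<and> \<alpha> = 1) \<longrightarrow>
      (\<exists>f'. (f has_real_derivative f') (at t within {a..}) \<and>
        conformable_deriv a \<alpha> f t = (t - a) powr (1 - \<alpha>) * f'))"
proof -
  let ?K = "conformable_factor a \<alpha> t"
  have f: "conformable_differentiable a \<alpha> f t" and g: "conformable_differentiable a \<alpha> g t"
    using assms unfolding conformable_differentiable_on_def by auto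
  from f obtain f' where f': "(f has_real_derivative f') (at t within {a..})" and t: "t \<ge> a"
    and Df: "conformable_deriv a \<alpha> f t = ?K * f'"
    by (rule conformable_differentiableE)
  from g obtain g' where g': "(g has_real_derivative g') (at t within {a..})"
    and Dg: "conformable_deriv a \<alpha> g t = ?K * g'"
    by (rule conformable_differentiableE)
  note [derivative_intros] = f' g'
  have linear: "((\<lambda>s. c * f s + d * g s) has_real_derivative c * f' + d * g') (at t within {a..})"
    by (auto intro!: derivative_eq_intros)
  have product: "((\<lambda>s. f s * g s) has_real_derivative g t * f' + f t * g') (at t within {a..})"
    by (auto intro!: derivative_eq_intros)
  have quotient: "((\<lambda>s. f s * (1 / g s)) has_real_derivative
      (g t * f' - f t * g') / (g t)\<^sup>2) (at t within {a..})" if "g t \<noteq> 0"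
    using that by (auto intro!: derivative_eq_intros simp: field_simps power2_eq_square)
  \<comment> \<open>By continuity of \<open>g\<close> at \<open>t\<close>, the convention
    \<open>1 / 0 = 0\<close> does not affect the quotient near \<open>t\<close>.\<close>
  have nonzero: "\<forall>\<^sub>F s in at t within {a..}. g s \<noteq> 0" if "g t \<noteq> 0"
    using DERIV_continuous[OF g'] that unfolding continuous_within
    by (rule tendsto_imp_eventually_ne)
  \<comment> \<open>In this and the next two rules the right-hand side is linear in the pair of
    derivatives, so the common factor \<open>?K\<close> can be pulled out.\<close>
  have "conformable_differentiable a \<alpha> (\<lambda>s. c * f s + d * g s) t \<and>
      conformable_deriv a \<alpha> (\<lambda>s. c * f s + d * g s) t =
        c * conformable_deriv a \<alpha> f t + d * conformable_deriv a \<alpha> g t"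
    using linear t by (rule has_conformable_derivativeI) (simp add: Df Dg algebra_simps)
  moreover have "conformable_differentiable a \<alpha> (\<lambda>s. f s * g s) t \<and>
      conformable_deriv a \<alpha> (\<lambda>s. f s * g s) t =
        g t * conformable_deriv a \<alpha> f t + f t * conformable_deriv a \<alpha> g t"
    using product t by (rule has_conformable_derivativeI) (simp add: Df Dg algebra_simps)
  moreover have "conformable_differentiable a \<alpha> (\<lambda>s. f s * (1 / g s)) t \<and>
      conformable_deriv a \<alpha> (\<lambda>s. f s * (1 / g s)) t =
        (g t * conformable_deriv a \<alpha> f t - f t * conformable_deriv a \<alpha> g t) / (g t)\<^sup>2"
    if "g t \<noteq> 0"
    using quotient[OF that] t
    by (rule has_conformable_derivativeI) (simp add: Df Dg algebra_simps)
  moreover have "conformable_differentiable a \<alpha> (\<lambda>s. 1) t \<and> conformable_deriv a \<alpha> (\<lambda>s. 1) t = 0"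
    using DERIV_const t by (rule has_conformable_derivativeI) simp
  \<comment> \<open>The exclusion leaves exactly the branch of \<open>conformable_factor\<close>
    that is the power.\<close>
  moreover have "\<exists>f'. (f has_real_derivative f') (at t within {a..}) \<and>
      conformable_deriv a \<alpha> f t = (t - a) powr (1 - \<alpha>) * f'" if "\<not> (t = a \<and> \<alpha> = 1)"
    using f' Df by (auto simp only: conformable_factor_def that if_False)
  ultimately show ?thesis
    using nonzero by (intro conjI impI) simp_all
qed

end
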